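(* Let $-\infty<L<R<\infty$ and let $p:\mathbb{R}\to[0,\infty)$ be a probability density function with support $[L,R]$ and distribution function $P$, satisfying the following conditions. (i) $p$ is continuous and positive on $(L,R)$, and there are finitely many points $L<y_1<\dots<y_m<R$ ($m\ge 0$) such that $p$ is continuously differentiable on each component interval of $S(p)=(L,R)\setminus\{y_1,\dots,y_m\}$. (ii) $\sup_{x\in S(p)}\left|\frac{p'(x)\min\{P(x),1-P(x)\}}{p^2(x)}\right|<\infty$. (iii) $\int_{S(p)}(1+|x|)\,|p'(x)|\,\mathrm{d}x<\infty$. (iv) $\lim_{x\searrow L}\frac{P(x)}{p(x)}=0$. (v) $\lim_{x\nearrow R}\frac{1-P(x)}{p(x)}=0$. Assume that the limit $\lim_{x\searrow L}p(x)$ exists. Let $X:\Omega\to(L,R)$ be a random variable with $\mathbb{P}(X\in S(p))=1$ and $\mathbb{E}\left|\frac{p'(X)}{p(X)}\right|<\infty$. Then $X$ has Lebesgue density $p$ if, and only if, the distribution function $F_X$ of $X$ satisfies $$1-F_X(t)=\mathbb{E}\left[\frac{p'(X)}{p(X)}\Big(R-\max\{X,t\}\Big)\right]+(R-t)\lim_{x\searrow L}p(x),\quad L<t<R.$$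
   Context: $(\Omega,\mathcal{A},\mathbb{P})$ is a probability space. $F_X(t)=\mathbb{P}(X\le t)$ is the distribution function of $X$. "$X$ has Lebesgue density $p$" means that the law of $X$ is $p\,\mathcal{L}^1$, where $\mathcal{L}^1$ is Lebesgue measure on $\mathbb{R}$. $P(x)=\int_{L}^x p(s)\,\mathrm{d}s$ for $x\in[L,R]$. The case $m=0$ is allowed. "The limit exists" means that it exists as a (finite) real number. *)

theory Defs
  imports "HOL-Probability.Probability"
begin

end

theory Submission
  imports Defs
begin

text \<open>
  Write \<open>\<mu>\<close> for the law of \<open>X\<close>, \<open>\<rho> = p' / p\<close> on \<open>S\<close>, and \<open>l\<close> for the limit of \<open>p\<close> at \<open>L\<close>. Since
  \<open>R - max x t\<close> is the length of the set of all \<open>s\<close> in \<open>[t, R]\<close> with \<open>x \<le> s\<close>, Fubini turns the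
  right-hand side of the identity into \<open>\<integral>\<^sub>t\<^sup>R g(s) ds\<close>, where \<open>g(s) = l + \<integral> \<rho>(x) 1{x \<le> s} d\<mu>(x)\<close>
  (lemma \<open>integral_times_overshoot\<close>). The identity thus says that the tail of \<open>\<mu>\<close> is the tail
  integral of \<open>g\<close>, a function that itself depends on \<open>\<mu>\<close>.

  If \<open>\<mu>\<close> has density \<open>p\<close>, then \<open>g(s) = l + \<integral>\<^sub>L\<^sup>s p'\<close>, which is \<open>p(s)\<close> by the fundamental theorem
  of calculus (lemma \<open>eq_left_limit_plus_integral_deriv\<close>), and the identity is the definition of a
  density.

  Conversely, suppose the identity. The tails of \<open>\<mu>\<close> decrease and \<open>g\<close> is right-continuous, so
  \<open>g \<ge> 0\<close> on \<open>(L, R)\<close> and \<open>g\<close> is a density of \<open>\<mu>\<close>. Inserting this into the definition of \<open>g\<close> gives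
  the integral equation \<open>g(s) = l + \<integral>\<^sub>L\<^sup>s \<rho> g\<close>. Hence \<open>g\<close> is continuous and \<open>g' = \<rho> g\<close> off the finite
  exceptional set. As \<open>p' = \<rho> p\<close> there too, \<open>g / p\<close> has derivative zero off a finite set
  and is continuous, so \<open>g = c p\<close> (lemma \<open>integral_equation_solution_proportional\<close>). Both functions
  have total mass one, whence \<open>c = 1\<close>.
\<close>

section \<open>Indefinite Lebesgue integrals on the line\<close>

lemma integrable_imp_set_integrable:
  fixes h :: "'a \<Rightarrow> 'b::{banach, second_countable_topology}"
  assumes "integrable M h" "A \<in> sets M"
  shows "set_integrable M A h"
  unfolding set_integrable_def using assms(2,1) by (rule integrable_mult_indicator)

lemma set_integrable_const_lborel:
  fixes c :: real
  assumes "A \<in> sets borel" "bounded A"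
  shows "set_integrable lborel A (\<lambda>_. c)"
  unfolding set_integrable_def
  using assms emeasure_bounded_finite[OF assms(2)] by simp

text \<open>
  The bridge from Lebesgue integrals over half-lines, which arise from distribution functions, to
  gauge integrals over compact intervals, for which continuity and differentiability in the upper
  endpoint are known.
\<close>
lemma set_integral_atMost_split:
  fixes h :: "real \<Rightarrow> real"
  assumes h: "integrable lborel h" and "c \<le> x"
  shows "(LINT s:{..x}|lborel. h s) = (LINT s:{..<c}|lborel. h s) + integral {c..x} h"
proof -
  have int: "set_integrable lborel A h" if "A \<in> sets borel" for A
    using that h by (intro integrable_imp_set_integrable) auto
  have "{..x} = {..<c} \<union> {c..x}"
    using \<open>c \<le> x\<close> by auto
  then have "(LINT s:{..x}|lborel. h s) = (LINT s:{..<c}|lborel. h s) + (LINT s:{c..x}|lborel. h s)"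
    by (simp only:, subst set_integral_Un) (auto intro: int)
  then show ?thesis
    by (simp add: set_borel_integral_eq_integral(2)[OF int])
qed

lemma isCont_set_integral_atMost:
  fixes h :: "real \<Rightarrow> real"
  assumes h: "integrable lborel h"
  shows "isCont (\<lambda>x. LINT s:{..x}|lborel. h s) x"
proof -
  have "set_integrable lborel {x - 1..x + 1} h"
    using h by (rule integrable_imp_set_integrable) simp
  then have "continuous_on {x - 1..x + 1} (\<lambda>y. integral {x - 1..y} h)"
    by (intro indefinite_integral_continuous_1 set_borel_integral_eq_integral(1))
  then have "continuous_on {x - 1..x + 1} (\<lambda>y. (LINT s:{..<x - 1}|lborel. h s) + integral {x - 1..y} h)"
    by (intro continuous_intros)
  then have "continuous_on {x - 1..x + 1} (\<lambda>y. LINT s:{..y}|lborel. h s)"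
    by (subst continuous_on_cong[OF refl]) (auto intro: set_integral_atMost_split[OF h])
  then show ?thesis
    by (rule continuous_on_interior) simp
qed

lemma has_real_derivative_set_integral_atMost:
  fixes h :: "real \<Rightarrow> real"
  assumes h: "integrable lborel h" and "isCont h x"
  shows "((\<lambda>x. LINT s:{..x}|lborel. h s) has_real_derivative h x) (at x)"
proof -
  have "set_integrable lborel {x - 1..x + 1} h"
    using h by (rule integrable_imp_set_integrable) simp
  then have "((\<lambda>y. integral {x - 1..y} h) has_vector_derivative h x) (at x within ({x - 1..x + 1} - {}))"
    by (intro integral_has_vector_derivative_continuous_at set_borel_integral_eq_integral(1))
       (use \<open>isCont h x\<close> in \<open>auto intro: continuous_at_imp_continuous_at_within\<close>)
  then have "((\<lambda>y. integral {x - 1..y} h) has_real_derivative h x) (at x)"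
    by (simp add: has_real_derivative_iff_has_vector_derivative at_within_Icc_at)
  then have "((\<lambda>y. (LINT s:{..<x - 1}|lborel. h s) + integral {x - 1..y} h) has_real_derivative h x) (at x)"
    by (auto intro!: derivative_eq_intros)
  then show ?thesis
    by (rule has_field_derivative_transform_within_open[where S = "{x - 1<..<x + 1}"])
       (auto simp: set_integral_atMost_split[OF h, where c = "x - 1"])
qed

text \<open>
  The function \<open>p\<close> need not be continuous at \<open>L\<close>. The fundamental theorem of calculus applies to the
  continuous function that results from giving \<open>p\<close> the value \<open>l\<close> at \<open>L\<close>; a finite set of points
  without derivative is harmless.
\<close>
lemma eq_left_limit_plus_integral_deriv:
  fixes p q :: "real \<Rightarrow> real"
  assumes "finite Y" and p: "continuous_on {L<..<R} p"
    and deriv: "\<And>x. x \<in> {L<..<R} - Y \<Longrightarrow> (p has_real_derivative q x) (at x)"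
    and q: "integrable lborel q" and q0: "\<And>x. x \<le> L \<Longrightarrow> q x = 0"
    and l: "(p \<longlongrightarrow> l) (at_right L)" and x: "x \<in> {L<..<R}"
  shows "p x = l + (LINT s:{..x}|lborel. q s)"
proof -
  define p0 where "p0 y = (if y \<le> L then l else p y)" for y
  have "isCont p y" if "y \<in> {L<..<R}" for y
    using p that by (simp add: continuous_on_eq_continuous_at)
  have "(p0 \<longlongrightarrow> l) (at_right L)"
    by (rule Lim_transform_eventually[OF l]) (auto simp: eventually_at_right_less p0_def eventually_at_filter)
  then have "continuous (at_right L) p0"
    by (simp add: continuous_within p0_def)
  have near: "eventually (\<lambda>z. p z = p0 z) (nhds y)" if "L < y" for y
    using eventually_nhds_in_open[of "{L<..}" y] that
    by (auto elim!: eventually_mono simp: p0_def)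
  have cont: "continuous_on {L..x} p0"
  proof (subst continuous_on_eq_continuous_within, intro ballI)
    fix y assume y: "y \<in> {L..x}"
    show "continuous (at y within {L..x}) p0"
    proof (cases "y = L")
      case True
      have "at L within {L..x} = at_right L"
        using x by (intro at_within_Icc_at_right) auto
      with True \<open>continuous (at_right L) p0\<close> show ?thesis by simp
    next
      case False
      then have "isCont p0 y"
        using isCont_cong[OF near[of y]] \<open>\<And>y. y \<in> {L<..<R} \<Longrightarrow> isCont p y\<close> y x by auto
      then show ?thesis by (rule continuous_at_imp_continuous_at_within)
    qed
  qed
  have "(q has_integral (p0 x - p0 L)) {L..x}"
  proof (rule fundamental_theorem_of_calculus_interior_strong[OF \<open>finite Y\<close> _ _ cont])
    fix y assume y: "y \<in> {L<..<x} - Y"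
    then have "(p has_real_derivative q y) (at y)"
      using x by (intro deriv) auto
    then have "(p0 has_real_derivative q y) (at y)"
      using DERIV_cong_ev[OF refl near[of y] refl] y by auto
    then show "(p0 has_vector_derivative q y) (at y)"
      by (simp add: has_real_derivative_iff_has_vector_derivative)
  qed (use x in auto)
  then have "integral {L..x} q = p x - l"
    using x by (simp add: p0_def integral_unique)
  moreover have "(LINT s:{..<L}|lborel. q s) = (LINT s:{..<L}|lborel. 0)"
    by (intro set_lebesgue_integral_cong) (auto simp: q0)
  ultimately show ?thesis
    using set_integral_atMost_split[OF q, of L x] x by simp
qed

section \<open>Partial moments of a finite measure\<close>

text \<open>
  Both claims are Fubini for \<open>f x s = \<rho> x\<close> on the region \<open>max x t \<le> s \<le> R\<close>: its integral over \<open>s\<close>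
  is \<open>\<rho> x * (R - max x t)\<close>, and for fixed \<open>s\<close> in \<open>[t, R]\<close> its integral over \<open>x\<close> is the partial moment.
\<close>
lemma
  fixes \<rho> :: "real \<Rightarrow> real"
  assumes "finite_measure \<mu>" and sets: "sets \<mu> = sets borel"
    and \<rho>: "integrable \<mu> \<rho>" and R: "AE x in \<mu>. x \<le> R" and "t \<le> R"
  shows set_integrable_partial_moments:
      "set_integrable lborel {t..R} (\<lambda>s. LINT x:{..s}|\<mu>. \<rho> x)"
    and integral_times_overshoot:
      "(LINT x|\<mu>. \<rho> x * (R - max x t)) = (LINT s:{t..R}|lborel. (LINT x:{..s}|\<mu>. \<rho> x))"
proof -
  interpret finite_measure \<mu> by fact
  interpret pair_sigma_finite \<mu> lborel ..
  have [measurable_cong]: "sets \<mu> = sets borel" by fact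
  have [measurable]: "\<rho> \<in> borel_measurable borel"
    using \<rho> by (simp add: measurable_cong_sets[OF sets refl, symmetric])
  define f where "f x s = \<rho> x * indicator {max x t..R} s" for x s
  have f_eq: "f x s = indicator {t..R} s * (indicator {..s} x * \<rho> x)" for x s
    by (auto simp: f_def indicator_def)
  have f_meas: "case_prod f \<in> borel_measurable (\<mu> \<Otimes>\<^sub>M lborel)"
    unfolding f_def indicator_def atLeastAtMost_iff by measurable
  have len: "measure lborel {max x t..R} = R - max x t" if "x \<le> R" for x
    using that \<open>t \<le> R\<close> by simp
  have inner: "(LINT s|lborel. f x s) = \<rho> x * (R - max x t)" if "x \<le> R" for x
    using len[OF that] by (simp add: f_def)
  have inner_norm: "(LINT s|lborel. norm (f x s)) = \<bar>\<rho> x\<bar> * (R - max x t)" if "x \<le> R" for x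
    using len[OF that] by (simp add: f_def abs_mult)
  have "integrable \<mu> (\<lambda>x. LINT s|lborel. norm (f x s))"
  proof (rule Bochner_Integration.integrable_bound)
    show "integrable \<mu> (\<lambda>x. (R - t) * \<bar>\<rho> x\<bar>)"
      using \<rho> by simp
    show "(\<lambda>x. LINT s|lborel. norm (f x s)) \<in> borel_measurable \<mu>"
      using f_meas by measurable
    show "AE x in \<mu>. norm (LINT s|lborel. norm (f x s)) \<le> norm ((R - t) * \<bar>\<rho> x\<bar>)"
      using R
    proof eventually_elim
      case (elim x)
      have "\<bar>\<rho> x\<bar> * (R - max x t) \<le> \<bar>\<rho> x\<bar> * (R - t)"
        by (intro mult_left_mono) auto
      then show ?case
        using inner_norm[OF elim] elim \<open>t \<le> R\<close> by (simp add: mult.commute abs_mult)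
    qed
  qed
  then have int: "integrable (\<mu> \<Otimes>\<^sub>M lborel) (case_prod f)"
    by (intro Fubini_integrable f_meas)
       (auto simp: f_def intro!: AE_I2 integrable_mult_right integrable_real_indicator emeasure_bounded_finite)
  have "(LINT s:{t..R}|lborel. (LINT x:{..s}|\<mu>. \<rho> x)) = (LINT s|lborel. LINT x|\<mu>. f x s)"
    by (simp add: f_eq set_lebesgue_integral_def)
  also have "\<dots> = (LINT x|\<mu>. LINT s|lborel. f x s)"
    using int by (rule Fubini_integral)
  also have "\<dots> = (LINT x|\<mu>. \<rho> x * (R - max x t))"
  proof (rule integral_cong_AE)
    show "(\<lambda>x. LINT s|lborel. f x s) \<in> borel_measurable \<mu>"
      using f_meas by measurable
    show "AE x in \<mu>. (LINT s|lborel. f x s) = \<rho> x * (R - max x t)"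
      using R by eventually_elim (rule inner)
  qed measurable
  finally show "(LINT x|\<mu>. \<rho> x * (R - max x t)) = (LINT s:{t..R}|lborel. (LINT x:{..s}|\<mu>. \<rho> x))" ..
  show "set_integrable lborel {t..R} (\<lambda>s. LINT x:{..s}|\<mu>. \<rho> x)"
    using integrable_snd[OF int] by (simp add: f_eq set_integrable_def set_lebesgue_integral_def)
qed

text \<open>
  For a sequence decreasing to \<open>s\<close> the indicators of the half-lines are eventually constant at every
  point, including \<open>s\<close> itself, so that \<open>\<bar>\<rho>\<bar>\<close> dominates.
\<close>
lemma partial_moment_right_continuous:
  fixes \<rho> :: "real \<Rightarrow> real"
  assumes sets: "sets \<mu> = sets borel" and \<rho>: "integrable \<mu> \<rho>"
  shows "((\<lambda>s. LINT x:{..s}|\<mu>. \<rho> x) \<longlongrightarrow> (LINT x:{..s}|\<mu>. \<rho> x)) (at_right s)"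
proof (rule tendsto_at_right_sequentially[where b = "s + 1"])
  fix u :: "nat \<Rightarrow> real" assume u: "\<And>n. s < u n" "decseq u" "u \<longlonglongrightarrow> s"
  have [measurable_cong]: "sets \<mu> = sets borel" by fact
  have [measurable]: "\<rho> \<in> borel_measurable borel"
    using \<rho> by (simp add: measurable_cong_sets[OF sets refl, symmetric])
  show "(\<lambda>n. LINT x:{..u n}|\<mu>. \<rho> x) \<longlonglongrightarrow> (LINT x:{..s}|\<mu>. \<rho> x)"
    unfolding set_lebesgue_integral_def
  proof (rule integral_dominated_convergence[where w = "\<lambda>x. \<bar>\<rho> x\<bar>"])
    show "AE x in \<mu>. (\<lambda>n. indicator {..u n} x *\<^sub>R \<rho> x) \<longlonglongrightarrow> indicator {..s} x *\<^sub>R \<rho> x"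
    proof (intro AE_I2 tendsto_eventually)
      fix x
      show "eventually (\<lambda>n. indicator {..u n} x *\<^sub>R \<rho> x = indicator {..s} x *\<^sub>R \<rho> x) sequentially"
      proof (cases "s < x")
        case True
        then have "eventually (\<lambda>n. u n < x) sequentially"
          using u(3) by (intro order_tendstoD)
        then show ?thesis
          by eventually_elim (use True in auto)
      next
        case False
        then have "x \<le> s" and "x \<le> u n" for n
          using u(1)[of n] by auto
        then show ?thesis by simp
      qed
    qed
  qed (use \<rho> in \<open>auto split: split_indicator\<close>)
qed simp

section \<open>Densities from tail integrals\<close>

text \<open>
  If \<open>g s < 0\<close>, then by right-continuity \<open>g < g s / 2\<close> on a short interval to the right of \<open>s\<close>;
  removing that interval would increase the tail integral. This gives the sign of a candidate
  density at every point, without extending the tail identity to all Borel sets first.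
\<close>
lemma right_continuous_nonneg_of_antimono_tail:
  fixes g :: "real \<Rightarrow> real"
  assumes g: "set_integrable lborel {s..R} g" and "s < R"
    and right: "(g \<longlongrightarrow> g s) (at_right s)"
    and tail: "\<And>t. s \<le> t \<Longrightarrow> t < R \<Longrightarrow> (LINT x:{t..R}|lborel. g x) \<le> (LINT x:{s..R}|lborel. g x)"
  shows "0 \<le> g s"
proof (rule ccontr)
  assume "\<not> 0 \<le> g s"
  then have "eventually (\<lambda>x. g x < g s / 2) (at_right s)"
    by (intro order_tendstoD[OF right]) auto
  then obtain b where b: "s < b" "\<And>x. s < x \<Longrightarrow> x < b \<Longrightarrow> g x < g s / 2"
    using eventually_at_right[OF \<open>s < R\<close>] by auto
  \<comment> \<open>the midpoint of \<open>s\<close> and \<open>min b R\<close> stays strictly below both \<open>b\<close> and \<open>R\<close>\<close>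
  define t where "t = (s + min b R) / 2"
  have t: "s < t" "t < R" "t < b"
    using b(1) \<open>s < R\<close> by (auto simp: t_def min_def field_simps)
  have int: "set_integrable lborel A g" if "A \<subseteq> {s..R}" "A \<in> sets borel" for A
    using g by (rule set_integrable_subset) (use that in auto)
  have split: "{s..R} = {s..<t} \<union> {t..R}"
    using t by auto
  have "(LINT x:{s..R}|lborel. g x) = (LINT x:{s..<t}|lborel. g x) + (LINT x:{t..R}|lborel. g x)"
    unfolding split by (rule set_integral_Un) (use t in \<open>auto intro!: int\<close>)
  moreover have "(LINT x:{s..<t}|lborel. g x) \<le> (LINT x:{s..<t}|lborel. g s / 2)"
  proof (rule set_integral_mono)
    show "set_integrable lborel {s..<t} g"
      using t by (intro int) auto
    show "g x \<le> g s / 2" if "x \<in> {s..<t}" for x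
      using that b(2)[of x] t \<open>\<not> 0 \<le> g s\<close> by (cases "x = s") auto
  qed (auto intro: set_integrable_const_lborel)
  moreover have "(LINT x:{s..<t}|lborel. g s / 2) < 0"
    using t \<open>\<not> 0 \<le> g s\<close> by (simp add: set_lebesgue_integral_def mult_less_0_iff)
  ultimately show False
    using tail[of t] t by simp
qed

text \<open>
  The open half-lines to the right determine a finite measure. Those starting at or below \<open>L\<close> have
  the mass of the half-line from \<open>L\<close>, which is the limit of the half-lines from
  \<open>L + 1 / (n + 1)\<close>.
\<close>
lemma finite_measure_eqI_tails:
  fixes \<mu> \<nu> :: "real measure"
  assumes fin: "finite_measure \<mu>" and sets: "sets \<mu> = sets borel" "sets \<nu> = sets borel"
    and null: "emeasure \<mu> {..L} = 0" "emeasure \<nu> {..L} = 0" "emeasure \<mu> {R..} = 0" "emeasure \<nu> {R..} = 0"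
    and tails: "\<And>t. L < t \<Longrightarrow> t < R \<Longrightarrow> emeasure \<mu> {t<..} = emeasure \<nu> {t<..}"
  shows "\<mu> = \<nu>"
proof -
  have above: "emeasure \<mu> {t<..} = emeasure \<nu> {t<..}" if "L < t" for t
  proof (cases "t < R")
    case False
    then have sub: "{t<..} \<subseteq> {R..}" by auto
    have "emeasure m {t<..} = 0" if "sets m = sets borel" "emeasure m {R..} = 0" for m
      by (rule emeasure_eq_0[OF _ that(2) sub]) (simp add: that(1))
    then show ?thesis
      using null sets by metis
  next
    case True
    with that show ?thesis by (rule tails)
  qed
  have union: "{L<..} = (\<Union>n. {L + inverse (real (Suc n))<..})"
  proof safe
    fix x assume "L < x"
    then obtain n where "inverse (real (Suc n)) < x - L"
      using reals_Archimedean[of "x - L"] by auto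
    then show "x \<in> (\<Union>n. {L + inverse (real (Suc n))<..})"
      by (auto intro!: exI[of _ n])
  next
    fix x n assume "L + inverse (real (Suc n)) < x"
    moreover have "0 < inverse (real (Suc n))" by simp
    ultimately show "L < x" by linarith
  qed
  have "incseq (\<lambda>n. {L + inverse (real (Suc n))<..})"
    by (intro incseq_SucI) (simp add: le_imp_inverse_le)
  then have "(SUP n. emeasure \<mu> {L + inverse (real (Suc n))<..}) = emeasure \<mu> {L<..}"
    "(SUP n. emeasure \<nu> {L + inverse (real (Suc n))<..}) = emeasure \<nu> {L<..}"
    unfolding union by (intro SUP_emeasure_incseq; force simp: sets)+
  then have at_L: "emeasure \<mu> {L<..} = emeasure \<nu> {L<..}"
    using above by simp
  have below: "emeasure m {t<..} = emeasure m {L<..}"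
    if "t \<le> L" "sets m = sets borel" "emeasure m {..L} = 0" for t m
  proof -
    have "emeasure m {t<..L} = 0"
      by (rule emeasure_eq_0[where N = "{..L}"]) (use that in auto)
    moreover have "{t<..} = {t<..L} \<union> {L<..}" using that by auto
    moreover have "emeasure m ({t<..L} \<union> {L<..}) = emeasure m {t<..L} + emeasure m {L<..}"
      using that by (intro plus_emeasure[symmetric]) auto
    ultimately show ?thesis by simp
  qed
  show ?thesis
  proof (rule measure_eqI_lessThan[OF sets])
    show "emeasure \<mu> {t<..} < \<infinity>" for t
      using finite_measure.emeasure_finite[OF fin] by (simp add: less_top)
    show "emeasure \<mu> {t<..} = emeasure \<nu> {t<..}" for t
    proof (cases "L < t")
      case False
      then show ?thesis
        using below[of t \<mu>] below[of t \<nu>] at_L null(1,2) sets by simp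
    qed (rule above)
  qed
qed

text \<open>
  The endpoints \<open>t\<close> and \<open>R\<close> are null sets. This is why the sign of \<open>f\<close> is asked for only strictly
  between them and why the half-line can be traded for the closed interval.
\<close>
lemma emeasure_density_greaterThan:
  fixes f :: "real \<Rightarrow> real"
  assumes f: "set_integrable lborel {t..R} f" and nonneg: "\<And>x. t < x \<Longrightarrow> x < R \<Longrightarrow> 0 \<le> f x"
    and vanish: "AE x in lborel. R < x \<longrightarrow> f x = 0"
    and [measurable]: "f \<in> borel_measurable borel"
  shows "emeasure (density lborel (\<lambda>x. ennreal (f x))) {t<..} = ennreal (LINT x:{t..R}|lborel. f x)"
proof -
  have "emeasure (density lborel (\<lambda>x. ennreal (f x))) {t<..} =
      (\<integral>\<^sup>+x. ennreal (f x) * indicator {t<..} x \<partial>lborel)"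
    by (rule emeasure_density) auto
  also have "\<dots> = (\<integral>\<^sup>+x. ennreal (indicator {t..R} x * f x) \<partial>lborel)"
    using vanish AE_lborel_singleton[of t]
    by (intro nn_integral_cong_AE) (auto simp: indicator_def elim!: eventually_elim2)
  also have "\<dots> = ennreal (LINT x:{t..R}|lborel. f x)"
    unfolding set_lebesgue_integral_def real_scaleR_def
  proof (rule nn_integral_eq_integral)
    show "integrable lborel (\<lambda>x. indicator {t..R} x * f x)"
      using f by (simp add: set_integrable_def)
    show "AE x in lborel. 0 \<le> indicator {t..R} x * f x"
      using AE_lborel_singleton[of t] AE_lborel_singleton[of R]
      by eventually_elim (auto simp: indicator_def intro!: nonneg)
  qed
  finally show ?thesis .
qed

lemma set_integral_density:
  fixes f :: "real \<Rightarrow> real" and \<rho> :: "real \<Rightarrow> real"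
  assumes "\<rho> \<in> borel_measurable borel" "f \<in> borel_measurable borel" "\<And>x. 0 \<le> f x" "A \<in> sets borel"
  shows "(LINT x:A|density lborel (\<lambda>x. ennreal (f x)). \<rho> x) = (LINT x:A|lborel. \<rho> x * f x)"
  unfolding set_lebesgue_integral_def using assms
  by (subst integral_density) (auto simp: ac_simps)

section \<open>The integral equation of the candidate density\<close>

text \<open>
  The integral equation makes \<open>g\<close> continuous, hence \<open>h = a g\<close> continuous off \<open>Y\<close>, hence \<open>g\<close>
  differentiable there with \<open>g' = a g\<close>. Since \<open>p\<close> solves the same linear equation, \<open>(g / p)' = 0\<close> off
  \<open>Y\<close>; continuity of \<open>g / p\<close> carries the constant across the points of \<open>Y\<close>.
\<close>
lemma integral_equation_solution_proportional:
  fixes a g h p :: "real \<Rightarrow> real"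
  assumes "finite Y" and a: "continuous_on ({L<..<R} - Y) a"
    and h: "integrable lborel h" and h_eq: "\<And>x. x \<in> {L<..<R} - Y \<Longrightarrow> h x = a x * g x"
    and g: "\<And>x. x \<in> {L<..<R} \<Longrightarrow> g x = l + (LINT s:{..x}|lborel. h s)"
    and p: "continuous_on {L<..<R} p" and p_pos: "\<And>x. x \<in> {L<..<R} \<Longrightarrow> 0 < p x"
    and p_deriv: "\<And>x. x \<in> {L<..<R} - Y \<Longrightarrow> (p has_real_derivative a x * p x) (at x)"
  obtains c where "\<And>x. x \<in> {L<..<R} \<Longrightarrow> g x = c * p x"
proof (cases "{L<..<R} = {}")
  case False
  then obtain x0 where x0: "x0 \<in> {L<..<R}" by blast
  have "open ({L<..<R} - Y)"
    using \<open>finite Y\<close> by (intro open_Diff finite_imp_closed) auto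
  have g_near: "eventually (\<lambda>z. l + (LINT s:{..z}|lborel. h s) = g z) (nhds x)" if "x \<in> {L<..<R}" for x
    using eventually_nhds_in_open[of "{L<..<R}" x] that by (auto elim!: eventually_mono simp: g)
  have "isCont (\<lambda>x. l + (LINT s:{..x}|lborel. h s)) x" for x
    by (intro continuous_intros isCont_set_integral_atMost h)
  then have g_cont: "isCont g x" if "x \<in> {L<..<R}" for x
    using isCont_cong[OF g_near[OF that]] by simp
  have g_deriv: "(g has_real_derivative a x * g x) (at x)" if x: "x \<in> {L<..<R} - Y" for x
  proof -
    have "isCont a x"
      using a x \<open>open ({L<..<R} - Y)\<close> by (simp add: continuous_on_eq_continuous_at)
    then have "isCont (\<lambda>z. a z * g z) x"
      using g_cont x by (intro continuous_intros) auto
    moreover have "eventually (\<lambda>z. a z * g z = h z) (nhds x)"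
      using eventually_nhds_in_open[OF \<open>open ({L<..<R} - Y)\<close> x] by (auto elim!: eventually_mono simp: h_eq)
    ultimately have "isCont h x"
      using isCont_cong[of "\<lambda>z. a z * g z" h x] by simp
    then have "((\<lambda>x. l + (LINT s:{..x}|lborel. h s)) has_real_derivative h x) (at x)"
      by (auto intro!: derivative_eq_intros has_real_derivative_set_integral_atMost h)
    then show ?thesis
      using DERIV_cong_ev[OF refl g_near refl] x h_eq by auto
  qed
  have "g x / p x = g x0 / p x0" if "x \<in> {L<..<R}" for x
  proof (rule has_derivative_zero_unique_strong_connected[where f = "\<lambda>x. g x / p x" and K = Y and S = "{L<..<R}"])
    show "continuous_on {L<..<R} (\<lambda>x. g x / p x)"
    proof (intro continuous_on_divide p)
      show "continuous_on {L<..<R} g"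
        by (intro continuous_at_imp_continuous_on ballI g_cont)
    qed (use p_pos in \<open>auto simp: less_imp_neq[symmetric]\<close>)
    show "((\<lambda>x. g x / p x) has_derivative (\<lambda>h. 0)) (at y within {L<..<R})" if y: "y \<in> {L<..<R} - Y" for y
    proof -
      have "((\<lambda>x. g x / p x) has_real_derivative
          ((a y * g y) * p y - g y * (a y * p y)) / (p y * p y)) (at y)"
        using p_pos[of y] y by (intro DERIV_divide g_deriv p_deriv) auto
      then show ?thesis
        by (auto simp: has_field_derivative_def lambda_zero intro: has_derivative_at_withinI)
    qed
  qed (use x0 that \<open>finite Y\<close> in auto)
  then have "g x = g x0 / p x0 * p x" if "x \<in> {L<..<R}" for x
    using p_pos[OF that] that by (metis less_irrefl nonzero_eq_divide_eq)
  then show ?thesis by (rule that)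
qed (use that in auto)

section \<open>The characterization\<close>

text \<open>
  The statement about laws on the line. Here \<open>d\<close> is the derivative of \<open>p\<close>, and \<open>\<rho>\<close> is set to
  zero on the finite exceptional set and outside \<open>(L, R)\<close>, which makes it a Borel function
  on the whole line.
\<close>
lemma density_iff_tail_identity:
  fixes d p :: "real \<Rightarrow> real"
  assumes "L < R" "finite Y"
    and p_meas [measurable]: "p \<in> borel_measurable borel" and p_nonneg: "\<And>x. 0 \<le> p x"
    and p_total: "(\<integral>\<^sup>+x. ennreal (p x) \<partial>lborel) = 1"
    and p_outside: "\<And>x. x \<notin> {L..R} \<Longrightarrow> p x = 0"
    and p_cont: "continuous_on {L<..<R} p" and p_pos: "\<And>x. x \<in> {L<..<R} \<Longrightarrow> 0 < p x"
    and p_deriv: "\<And>x. x \<in> {L<..<R} - Y \<Longrightarrow> (p has_real_derivative d x) (at x)"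
    and d_cont: "continuous_on ({L<..<R} - Y) d"
    and l: "(p \<longlongrightarrow> l) (at_right L)"
    and \<mu>: "real_distribution \<mu>" and \<mu>_S: "AE x in \<mu>. x \<in> {L<..<R} - Y"
    and \<rho>_def: "\<rho> = (\<lambda>x. if x \<in> {L<..<R} - Y then d x / p x else 0)"
    and \<rho>_int: "integrable \<mu> \<rho>"
  shows "\<mu> = density lborel (\<lambda>x. ennreal (p x)) \<longleftrightarrow>
    (\<forall>t. L < t \<and> t < R \<longrightarrow>
      1 - cdf \<mu> t = (LINT x|\<mu>. \<rho> x * (R - max x t)) + (R - t) * l)"
proof -
  interpret \<mu>: real_distribution \<mu> by fact
  have \<rho>_meas [measurable]: "\<rho> \<in> borel_measurable borel"
    using \<rho>_int by (simp add: measurable_cong_sets[OF \<mu>.events_eq_borel refl, symmetric])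
  define g where "g s = l + (LINT x:{..s}|\<mu>. \<rho> x)" for s
  have g_meas [measurable]: "g \<in> borel_measurable borel"
    unfolding g_def set_lebesgue_integral_def indicator_def atMost_iff by measurable
  have \<mu>_le_R: "AE x in \<mu>. x \<le> R"
    using \<mu>_S by eventually_elim auto
  note moments = \<mu>.finite_measure_axioms \<mu>.events_eq_borel \<rho>_int \<mu>_le_R
  have l_int: "set_integrable lborel {t..R} (\<lambda>_. l)" for t
    by (auto intro: set_integrable_const_lborel)
  have g_int: "set_integrable lborel {t..R} g" if "t \<le> R" for t
    unfolding g_def by (rule set_integral_add(1)[OF l_int set_integrable_partial_moments[OF moments that]])
  have rhs: "(LINT x|\<mu>. \<rho> x * (R - max x t)) + (R - t) * l = (LINT s:{t..R}|lborel. g s)" if "t \<le> R" for t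
  proof -
    have "(LINT s:{t..R}|lborel. l) = (R - t) * l"
      using that by (simp add: set_lebesgue_integral_def)
    then show ?thesis
      unfolding g_def integral_times_overshoot[OF moments that]
        set_integral_add(2)[OF l_int set_integrable_partial_moments[OF moments that]] by simp
  qed
  have tail: "emeasure \<mu> {t<..} = ennreal (1 - cdf \<mu> t)" for t
  proof -
    have "space \<mu> - {..t} = {t<..}" by (auto simp: \<mu>.space_eq_univ)
    then have "\<mu>.prob {t<..} = 1 - cdf \<mu> t"
      using \<mu>.prob_compl[of "{..t}"] by (simp add: cdf_def)
    then show ?thesis by (simp add: \<mu>.emeasure_eq_measure)
  qed
  have null: "emeasure \<mu> {..L} = 0" "emeasure \<mu> {R..} = 0"
  proof -
    have "AE x in \<mu>. x \<notin> {..L}" "AE x in \<mu>. x \<notin> {R..}"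
      using \<mu>_S by (eventually_elim, auto)+
    then show "emeasure \<mu> {..L} = 0" "emeasure \<mu> {R..} = 0"
      using AE_iff_measurable[of "{..L}" \<mu> "\<lambda>x. x \<notin> {..L}"]
        AE_iff_measurable[of "{R..}" \<mu> "\<lambda>x. x \<notin> {R..}"]
      by (auto simp: \<mu>.space_eq_univ simp del: atMost_iff atLeast_iff)
  qed
  \<comment> \<open>applied to \<open>p\<close> in one direction, and in the other to \<open>g\<close> cut off outside \<open>(L, R)\<close>\<close>
  have equation: "g s = l + (LINT x:{..s}|lborel. \<rho> x * f x)" "integrable lborel (\<lambda>x. \<rho> x * f x)"
    if "\<mu> = density lborel (\<lambda>x. ennreal (f x))" "f \<in> borel_measurable borel" "\<And>x. 0 \<le> f x" for f s
  proof -
    show "g s = l + (LINT x:{..s}|lborel. \<rho> x * f x)"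
      unfolding g_def that(1) using that by (subst set_integral_density) auto
    have "integrable (density lborel (\<lambda>x. ennreal (f x))) \<rho>"
      using \<rho>_int that(1) by simp
    then show "integrable lborel (\<lambda>x. \<rho> x * f x)"
      using that(2,3) by (subst (asm) integrable_density) (auto simp: mult.commute)
  qed
  have "\<forall>t. L < t \<and> t < R \<longrightarrow> 1 - cdf \<mu> t = (LINT s:{t..R}|lborel. g s)"
    if eq: "\<mu> = density lborel (\<lambda>x. ennreal (p x))"
  proof (intro allI impI)
    fix t assume t: "L < t \<and> t < R"
    have \<rho>p: "\<rho> x * p x = d x" if "x \<in> {L<..<R} - Y" for x
      using that p_pos[of x] by (simp add: \<rho>_def)
    have "g x = p x" if x: "x \<in> {L<..<R}" for x
    proof -
      have "p x = l + (LINT x:{..x}|lborel. \<rho> x * p x)"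
      proof (rule eq_left_limit_plus_integral_deriv[OF \<open>finite Y\<close> p_cont _ equation(2)[OF eq p_meas p_nonneg] _ l x])
        show "(p has_real_derivative \<rho> x * p x) (at x)" if "x \<in> {L<..<R} - Y" for x
          using p_deriv[OF that] \<rho>p[OF that] by simp
      qed (simp add: \<rho>_def)
      then show ?thesis
        using equation(1)[OF eq p_meas p_nonneg] by simp
    qed
    then have "(LINT s:{t..R}|lborel. g s) = (LINT s:{t..R}|lborel. p s)"
      using t AE_lborel_singleton[of R]
      by (intro set_lebesgue_integral_cong_AE) (auto elim!: eventually_mono)
    moreover have "integrable lborel p"
      using p_total p_nonneg by (intro integrableI_nonneg) auto
    then have "emeasure \<mu> {t<..} = ennreal (LINT s:{t..R}|lborel. p s)"
      unfolding eq by (intro emeasure_density_greaterThan)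
        (auto simp: p_nonneg p_outside intro: integrable_imp_set_integrable)
    moreover have "0 \<le> (LINT s:{t..R}|lborel. p s)"
      unfolding set_lebesgue_integral_def by (intro integral_nonneg_AE) (auto simp: p_nonneg)
    ultimately show "1 - cdf \<mu> t = (LINT s:{t..R}|lborel. g s)"
      using tail[of t] \<mu>.cdf_bounded_prob[of t] by simp
  qed
  moreover have "\<mu> = density lborel (\<lambda>x. ennreal (p x))"
    if cdf: "\<And>t. L < t \<Longrightarrow> t < R \<Longrightarrow> 1 - cdf \<mu> t = (LINT s:{t..R}|lborel. g s)"
  proof -
    have g_nonneg: "0 \<le> g s" if s: "L < s" "s < R" for s
    proof (rule right_continuous_nonneg_of_antimono_tail[where g = g and s = s and R = R])
      show "(g \<longlongrightarrow> g s) (at_right s)"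
        unfolding g_def by (intro tendsto_intros partial_moment_right_continuous \<mu>.events_eq_borel \<rho>_int)
      show "(LINT x:{t..R}|lborel. g x) \<le> (LINT x:{s..R}|lborel. g x)" if "s \<le> t" "t < R" for t
        using cdf[of t] cdf[of s] \<mu>.cdf_nondecreasing[of s t] s that by simp
    qed (use s g_int in auto)
    \<comment> \<open>\<open>g\<close> has no reason to be nonnegative, or to vanish, outside \<open>(L, R)\<close>\<close>
    define f where "f x = indicator {L<..<R} x * g x" for x
    have f_meas [measurable]: "f \<in> borel_measurable borel"
      unfolding f_def by measurable
    have f_nonneg: "0 \<le> f x" for x
      by (auto simp: f_def indicator_def g_nonneg)
    have "\<mu> = density lborel (\<lambda>x. ennreal (f x))"
    proof (rule finite_measure_eqI_tails[where L = L and R = R])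
      show "emeasure \<mu> {t<..} = emeasure (density lborel (\<lambda>x. ennreal (f x))) {t<..}" if t: "L < t" "t < R" for t
      proof -
        have fg: "(LINT s:{t..R}|lborel. f s) = (LINT s:{t..R}|lborel. g s)"
          using t AE_lborel_singleton[of R]
          by (intro set_lebesgue_integral_cong_AE) (auto elim!: eventually_mono simp: f_def)
        have "set_integrable lborel {t..<R} g"
          using t by (intro set_integrable_subset[OF g_int[of t]]) auto
        moreover have "(\<lambda>x. indicator {t..<R} x *\<^sub>R g x) = (\<lambda>x. indicator {t..R} x *\<^sub>R f x)"
          using t by (auto simp: f_def indicator_def)
        ultimately have "set_integrable lborel {t..R} f"
          by (simp only: set_integrable_def)
        then have "emeasure (density lborel (\<lambda>x. ennreal (f x))) {t<..} = ennreal (LINT s:{t..R}|lborel. f s)"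
          by (rule emeasure_density_greaterThan) (auto simp: f_nonneg, simp add: f_def)
        then show ?thesis
          by (simp add: tail cdf[OF t] fg)
      qed
      show "emeasure (density lborel (\<lambda>x. ennreal (f x))) {..L} = 0"
        "emeasure (density lborel (\<lambda>x. ennreal (f x))) {R..} = 0"
        by (auto simp: emeasure_density nn_integral_0_iff_AE f_def indicator_def)
    qed (use null \<mu>.finite_measure_axioms in auto)
    note equation = equation[OF this f_meas f_nonneg] and \<mu>_f = this
    obtain c where c: "\<And>x. x \<in> {L<..<R} \<Longrightarrow> g x = c * p x"
    proof (rule integral_equation_solution_proportional[OF \<open>finite Y\<close> _ equation(2) _ equation(1) p_cont p_pos])
      show "continuous_on ({L<..<R} - Y) (\<lambda>x. d x / p x)"
        using p_pos by (intro continuous_on_divide d_cont continuous_on_subset[OF p_cont]) (auto simp: less_imp_neq[symmetric])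
      show "\<rho> x * f x = d x / p x * g x" if "x \<in> {L<..<R} - Y" for x
        using that by (simp add: \<rho>_def f_def)
      show "(p has_real_derivative d x / p x * p x) (at x)" if "x \<in> {L<..<R} - Y" for x
        using p_deriv[OF that] p_pos[of x] that by simp
    qed auto
    \<comment> \<open>comparing \<open>g\<close> with \<open>p\<close> at one interior point gives the sign of \<open>c\<close>, total masses its value\<close>
    define x0 where "x0 = (L + R) / 2"
    have "L < x0" "x0 < R" using \<open>L < R\<close> by (auto simp: x0_def)
    then have "0 \<le> c"
      using g_nonneg[of x0] c[of x0] p_pos[of x0] by (simp add: zero_le_mult_iff)
    have fcp: "AE x in lborel. f x = c * p x"
      using AE_lborel_singleton[of L] AE_lborel_singleton[of R]
      by eventually_elim (auto simp: f_def indicator_def c p_outside)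
    have "1 = (\<integral>\<^sup>+x. ennreal (f x) \<partial>lborel)"
      using \<mu>.emeasure_space_1 unfolding \<mu>_f by (simp add: emeasure_density)
    also have "\<dots> = (\<integral>\<^sup>+x. ennreal c * ennreal (p x) \<partial>lborel)"
      using fcp by (intro nn_integral_cong_AE) (auto elim!: eventually_mono simp: ennreal_mult \<open>0 \<le> c\<close> p_nonneg)
    also have "\<dots> = ennreal c"
      by (simp add: nn_integral_cmult p_total)
    finally have "c = 1"
      using \<open>0 \<le> c\<close> by simp
    then show ?thesis
      unfolding \<mu>_f using fcp by (intro density_cong) (auto elim!: eventually_mono)
  qed
  moreover have "(LINT x|\<mu>. \<rho> x * (R - max x t)) + (R - t) * l = (LINT s:{t..R}|lborel. g s)"
    if "L < t \<and> t < R" for t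
    using that by (intro rhs) auto
  ultimately show ?thesis
    by (simp cong: conj_cong imp_cong) blast
qed

theorem corollary6p7:
  fixes L R :: real and p P :: "real \<Rightarrow> real" and Y S :: "real set"
    and M :: "'a measure" and X :: "'a \<Rightarrow> real"
  assumes "L < R"
    and p_measurable: "p \<in> borel_measurable borel"
    and p_nonneg: "\<And>x. 0 \<le> p x"
    and p_total: "(\<integral>\<^sup>+x. ennreal (p x) \<partial>lborel) = 1"
    and p_support: "closure {x. p x \<noteq> 0} = {L..R}"
    and P: "\<And>x. x \<in> {L..R} \<Longrightarrow> P x = (LINT s:{L..x}|lborel. p s)"
    and i_cont: "continuous_on {L<..<R} p"
    and i_pos: "\<And>x. x \<in> {L<..<R} \<Longrightarrow> 0 < p x"
    and i_points: "finite Y" "Y \<subseteq> {L<..<R}"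
    and S: "S = {L<..<R} - Y"
    and i_C1: "\<And>C. C \<in> components S \<Longrightarrow> p C1_differentiable_on C"
    and ii: "bdd_above ((\<lambda>x. \<bar>deriv p x * min (P x) (1 - P x) / (p x)\<^sup>2\<bar>) ` S)"
    and iii: "(\<integral>\<^sup>+x\<in>S. ennreal ((1 + \<bar>x\<bar>) * \<bar>deriv p x\<bar>) \<partial>lborel) < \<infinity>"
    and iv: "((\<lambda>x. P x / p x) \<longlongrightarrow> 0) (at_right L)"
    and v: "((\<lambda>x. (1 - P x) / p x) \<longlongrightarrow> 0) (at_left R)"
    and p_limit: "\<exists>l. (p \<longlongrightarrow> l) (at_right L)"
    and "prob_space M"
    and X_rv: "X \<in> borel_measurable M"
    and X_range: "\<And>\<omega>. \<omega> \<in> space M \<Longrightarrow> X \<omega> \<in> {L<..<R}"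
    and X_S: "\<P>(\<omega> in M. X \<omega> \<in> S) = 1"
    and X_moment: "(\<integral>\<^sup>+\<omega>. ennreal \<bar>deriv p (X \<omega>) / p (X \<omega>)\<bar> \<partial>M) < \<infinity>"
  shows "distributed M lborel X (\<lambda>x. ennreal (p x)) \<longleftrightarrow>
    (\<forall>t. L < t \<and> t < R \<longrightarrow>
      1 - cdf (distr M borel X) t =
        (\<integral>\<omega>. deriv p (X \<omega>) / p (X \<omega>) * (R - max (X \<omega>) t) \<partial>M)
          + (R - t) * Lim (at_right L) p)"
proof -
  interpret prob_space M by fact
  note [measurable] = p_measurable X_rv
  obtain l where l: "(p \<longlongrightarrow> l) (at_right L)"
    using p_limit by blast
  then have Lim: "Lim (at_right L) p = l"
    by (intro tendsto_Lim) auto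
  have "open S"
    unfolding S using i_points(1) by (intro open_Diff finite_imp_closed) auto
  then have S_meas [measurable]: "S \<in> sets borel" by simp
  have smooth: "(p has_real_derivative deriv p x) (at x)" "isCont (deriv p) x" if x: "x \<in> S" for x
  proof -
    obtain C where C: "C \<in> components S" "x \<in> C"
      using componentsI[OF x] connected_component_refl[OF x] by auto
    have "open C"
      using C(1) by (rule open_components[OF \<open>open S\<close>])
    obtain D where D: "\<And>y. y \<in> C \<Longrightarrow> (p has_real_derivative D y) (at y)" "continuous_on C D"
      using i_C1[OF C(1)] unfolding C1_differentiable_on_def has_real_derivative_iff_has_vector_derivative
      by blast
    have deriv_D: "deriv p y = D y" if "y \<in> C" for y
      using D(1)[OF that] by (rule DERIV_imp_deriv)
    show "(p has_real_derivative deriv p x) (at x)"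
      using D(1)[OF C(2)] deriv_D[OF C(2)] by simp
    have "continuous_on C (deriv p)"
      using D(2) by (rule continuous_on_cong[THEN iffD1, OF refl, rotated]) (simp add: deriv_D)
    then show "isCont (deriv p) x"
      using \<open>open C\<close> C(2) by (simp add: continuous_on_eq_continuous_at)
  qed
  have d_cont: "continuous_on S (deriv p)"
    by (intro continuous_at_imp_continuous_on ballI smooth)
  have d_meas [measurable]: "(\<lambda>x. indicator S x * deriv p x) \<in> borel_measurable borel"
    using borel_measurable_continuous_on_indicator[OF S_meas d_cont] by simp
  define \<rho> where "\<rho> x = (if x \<in> S then deriv p x / p x else 0)" for x
  have "\<rho> = (\<lambda>x. indicator S x * deriv p x / p x)"
    by (auto simp: \<rho>_def)
  then have \<rho>_meas [measurable]: "\<rho> \<in> borel_measurable borel"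
    by simp
  have X_AE: "AE \<omega> in M. X \<omega> \<in> S"
    using X_S by (simp add: prob_Collect_eq_1)
  then have \<rho>_AE: "AE \<omega> in M. deriv p (X \<omega>) / p (X \<omega>) = \<rho> (X \<omega>)"
    by eventually_elim (simp add: \<rho>_def)
  \<comment> \<open>\<open>X\<close> takes its values in \<open>(L, R)\<close>, where the quotient agrees with the Borel function \<open>\<rho>\<close> except
    at the finitely many points of \<open>Y\<close>.\<close>
  have score_meas: "(\<lambda>\<omega>. deriv p (X \<omega>) / p (X \<omega>)) \<in> borel_measurable M"
  proof -
    have "(\<lambda>x. if x \<in> {L<..<R} then deriv p x / p x else 0) \<in> borel_measurable borel"
      by (rule measurable_discrete_difference[OF \<rho>_meas countable_finite[OF i_points(1)]])
         (auto simp: \<rho>_def S)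
    then have "(\<lambda>\<omega>. if X \<omega> \<in> {L<..<R} then deriv p (X \<omega>) / p (X \<omega>) else 0) \<in> borel_measurable M"
      by (rule measurable_compose[OF X_rv])
    then show ?thesis
      by (rule measurable_cong[THEN iffD1, rotated]) (use X_range in auto)
  qed
  have "(\<integral>\<^sup>+\<omega>. ennreal (norm (\<rho> (X \<omega>))) \<partial>M) = (\<integral>\<^sup>+\<omega>. ennreal \<bar>deriv p (X \<omega>) / p (X \<omega>)\<bar> \<partial>M)"
    by (rule nn_integral_cong_AE) (use \<rho>_AE in \<open>eventually_elim, simp only: real_norm_def\<close>)
  then have "integrable M (\<lambda>\<omega>. \<rho> (X \<omega>))"
    using X_moment by (intro integrableI_bounded) (simp_all only:, measurable)
  then have \<rho>_int: "integrable (distr M borel X) \<rho>"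
    by (subst integrable_distr_eq) auto
  have rhs: "(\<integral>\<omega>. deriv p (X \<omega>) / p (X \<omega>) * (R - max (X \<omega>) t) \<partial>M)
      = (LINT x|distr M borel X. \<rho> x * (R - max x t))" for t
  proof -
    have "(\<integral>\<omega>. deriv p (X \<omega>) / p (X \<omega>) * (R - max (X \<omega>) t) \<partial>M)
        = (\<integral>\<omega>. \<rho> (X \<omega>) * (R - max (X \<omega>) t) \<partial>M)"
    proof (rule integral_cong_AE)
      show "AE \<omega> in M. deriv p (X \<omega>) / p (X \<omega>) * (R - max (X \<omega>) t) = \<rho> (X \<omega>) * (R - max (X \<omega>) t)"
        using \<rho>_AE by eventually_elim simp
    qed (intro borel_measurable_times score_meas, measurable)
    also have "\<dots> = (LINT x|distr M borel X. \<rho> x * (R - max x t))"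
      by (rule integral_distr[symmetric]) measurable
    finally show ?thesis .
  qed
  have "distributed M lborel X (\<lambda>x. ennreal (p x)) \<longleftrightarrow>
      distr M borel X = density lborel (\<lambda>x. ennreal (p x))"
    by (simp add: distributed_def distr_cong[OF refl sets_lborel refl])
  also have "\<dots> \<longleftrightarrow> (\<forall>t. L < t \<and> t < R \<longrightarrow> 1 - cdf (distr M borel X) t =
      (LINT x|distr M borel X. \<rho> x * (R - max x t)) + (R - t) * l)"
  proof (rule density_iff_tail_identity[OF \<open>L < R\<close> i_points(1) p_measurable p_nonneg p_total _ i_cont i_pos])
    show "p x = 0" if "x \<notin> {L..R}" for x
      using that closure_subset[of "{x. p x \<noteq> 0}"] unfolding p_support by blast
    show "AE x in distr M borel X. x \<in> {L<..<R} - Y"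
      using X_AE unfolding S[symmetric] by (simp add: AE_distr_iff)
    show "\<rho> = (\<lambda>x. if x \<in> {L<..<R} - Y then deriv p x / p x else 0)"
      by (simp add: fun_eq_iff \<rho>_def S)
  qed (use smooth d_cont l \<rho>_int S in auto)
  finally show ?thesis
    by (simp only: rhs Lim)
qed

end
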